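(* In the setting of the context, with all competing regression models linear in their parameters, there exists a $T_p$-optimal discriminating design for the class $\mathcal{M}$ with at most $n+1$ support points, where $n=\sum_{(i,j)\in\mathcal{I}}\dim\Theta^{(j)}$ is the total number of parameters.
   Context: A design is a probability measure $\xi$ with finite support on a (nonempty) compact design space $\mathcal{X}$. Let $\mathcal{M}=\{\eta_1,\dots,\eta_k\}$ be a class of competing real-valued regression models that are linear in the parameters: $\eta_j(x,\theta_{(j)})=\theta_{(j)}^T g_j(x)$ with $\theta_{(j)}\in\Theta^{(j)}=\mathbb{R}^{n_j}$ and $g_j:\mathcal{X}\to\mathbb{R}^{n_j}$ continuous with linearly independent components. Let $p_{i,j}\ge 0$ ($1\le i\ne j\le k$) be given weights with $\sum_{i\neq j}p_{i,j}=1$, and $\mathcal{I}=\{(i,j)\mid 1\le i\ne j\le k,\ p_{i,j}>0\}$. For every $i$ occurring as a first index in $\mathcal{I}$ a parameter $\rho_{(i)}\in\Theta^{(i)}$ is fixed. For a design $\xi$ put $$T(\xi)=\sum_{(i,j)\in\mathcal{I}}p_{i,j}\inf_{\theta_{(j)}\in\Theta^{(j)}}\int_{\mathcal{X}}[\eta_i(x,\rho_{(i)})-\eta_j(x,\theta_{(j)})]^2\,d\xi(x).$$ A design is called $T_p$-optimal discriminating for $\mathcal{M}$ if it maximizes $T$ over all designs. *)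

theory Defs
  imports "HOL-Probability.Probability"
begin

text \<open>The parameter spaces of the competing models have different dimensions, so
  $\mathbb{R}^d$ is rendered as the set of functions on \<open>{..<d}\<close>, made extensional so that
  distinct functions are distinct vectors. The product topology on \<^typ>\<open>nat \<Rightarrow> real\<close>
  induces the Euclidean topology on this set.\<close>

definition Rn :: "nat \<Rightarrow> (nat \<Rightarrow> real) set"
  where "Rn d = {..<d} \<rightarrow>\<^sub>E UNIV"

definition inner_Rn :: "nat \<Rightarrow> (nat \<Rightarrow> real) \<Rightarrow> (nat \<Rightarrow> real) \<Rightarrow> real"
  where "inner_Rn d u v = (\<Sum>l<d. u l * v l)"

definition lin_indep_components :: "'a set \<Rightarrow> nat \<Rightarrow> ('a \<Rightarrow> nat \<Rightarrow> real) \<Rightarrow> bool"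
  where "lin_indep_components X d g \<longleftrightarrow>
    (\<forall>c\<in>Rn d. (\<forall>x\<in>X. (\<Sum>l<d. c l * g x l) = 0) \<longrightarrow> (\<forall>l<d. c l = 0))"

definition is_design :: "'a set \<Rightarrow> 'a pmf \<Rightarrow> bool"
  where "is_design X \<xi> \<longleftrightarrow> finite (set_pmf \<xi>) \<and> set_pmf \<xi> \<subseteq> X"

definition model_pairs :: "nat \<Rightarrow> (nat \<times> nat) set"
  where "model_pairs k = {(i, j). i \<in> {1..k} \<and> j \<in> {1..k} \<and> i \<noteq> j}"

definition active_pairs :: "nat \<Rightarrow> (nat \<Rightarrow> nat \<Rightarrow> real) \<Rightarrow> (nat \<times> nat) set"
  where "active_pairs k p = {(i, j) \<in> model_pairs k. p i j > 0}"

definition T_crit ::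
  "nat \<Rightarrow> (nat \<Rightarrow> nat \<Rightarrow> real) \<Rightarrow> (nat \<Rightarrow> 'b set) \<Rightarrow> (nat \<Rightarrow> 'a \<Rightarrow> 'b \<Rightarrow> real) \<Rightarrow>
   (nat \<Rightarrow> 'b) \<Rightarrow> 'a pmf \<Rightarrow> real"
  where "T_crit k p \<Theta> \<eta> \<rho> \<xi> =
    (\<Sum>(i, j)\<in>active_pairs k p.
       p i j * (INF \<theta>\<in>\<Theta> j. measure_pmf.expectation \<xi> (\<lambda>x. (\<eta> i x (\<rho> i) - \<eta> j x \<theta>)\<^sup>2)))"

definition Tp_optimal ::
  "'a set \<Rightarrow> nat \<Rightarrow> (nat \<Rightarrow> nat \<Rightarrow> real) \<Rightarrow> (nat \<Rightarrow> 'b set) \<Rightarrow> (nat \<Rightarrow> 'a \<Rightarrow> 'b \<Rightarrow> real) \<Rightarrow>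
   (nat \<Rightarrow> 'b) \<Rightarrow> 'a pmf \<Rightarrow> bool"
  where "Tp_optimal X k p \<Theta> \<eta> \<rho> \<xi> \<longleftrightarrow>
    is_design X \<xi> \<and> (\<forall>\<xi>'. is_design X \<xi>' \<longrightarrow> T_crit k p \<Theta> \<eta> \<rho> \<xi>' \<le> T_crit k p \<Theta> \<eta> \<rho> \<xi>)"

end

theory Submission
  imports Defs
begin

text \<open>Let \<open>\<theta>\<close> collect one parameter vector per active pair, so that \<open>\<theta>\<close> ranges over \<open>n\<close> dimensions,
  and let \<open>\<Psi> x \<theta>\<close> be the weighted sum of the squared residuals at \<open>x\<close>. Linear independence of
  the regression functions makes the supremum of \<open>\<Psi> x \<theta>\<close> over \<open>x\<close> coercive in \<open>\<theta>\<close>, hence it has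
  a minimiser, with minimal value \<open>M\<close>. There zero must lie in the convex hull of the gradients of
  \<open>\<Psi> x\<close> at the points \<open>x\<close> with \<open>\<Psi> x \<theta> = M\<close>, since otherwise a separating hyperplane gives a
  descent direction. By Caratheodory at most \<open>n + 1\<close> such points suffice, and their weights
  form a design for which \<open>\<theta>\<close> solves the normal equations. Its criterion value is therefore \<open>M\<close>,
  while every design has criterion at most \<open>M\<close>, as is seen by inserting \<open>\<theta>\<close> into the infima.\<close>

section \<open>Linear algebra and the Caratheodory reduction\<close>

text \<open>Gaussian elimination, by induction on the equations: an equation \<open>e\<close> with a
  nonzero coefficient at some unknown \<open>a\<close> is used to eliminate \<open>a\<close> from
  the others, which leaves one equation and one unknown fewer.\<close>

lemma nontrivial_solution:
  fixes M :: "'e \<Rightarrow> 'i \<Rightarrow> real"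
  assumes "finite E" "finite S" "card E < card S"
  shows "\<exists>c. (\<exists>i\<in>S. c i \<noteq> 0) \<and> (\<forall>e\<in>E. (\<Sum>i\<in>S. c i * M e i) = 0)"
  using assms
proof (induction E arbitrary: S M rule: finite_induct)
  case empty
  then have "S \<noteq> {}" by auto
  then show ?case by (intro exI[of _ "\<lambda>_. 1"]) auto
next
  case (insert e E)
  show ?case
  proof (cases "\<forall>i\<in>S. M e i = 0")
    case True
    have "card E < card S" using insert by simp
    from insert.IH[OF insert.prems(1) this, of M] True show ?thesis by auto
  next
    case False
    then obtain a where a: "a \<in> S" "M e a \<noteq> 0" by auto
    define S' where "S' = S - {a}"
    have S': "finite S'" "a \<notin> S'" "S = insert a S'"
      using a insert.prems by (auto simp: S'_def)
    have "card E < card S'" using insert S' by simp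
    \<comment> \<open>These are the coefficients after elimination of \<open>a\<close>; the value
      \<open>b\<close> below is the one that equation \<open>e\<close> then forces on
      \<open>a\<close>.\<close>
    from insert.IH[OF S'(1) this, of "\<lambda>f i. M f i - M f a * M e i / M e a"]
    obtain c where c: "\<exists>i\<in>S'. c i \<noteq> 0"
      "\<And>f. f \<in> E \<Longrightarrow> (\<Sum>i\<in>S'. c i * (M f i - M f a * M e i / M e a)) = 0" by auto
    define b where "b = - (\<Sum>i\<in>S'. c i * M e i) / M e a"
    have sum_S: "(\<Sum>i\<in>S. (c(a := b)) i * M f i) = b * M f a + (\<Sum>i\<in>S'. c i * M f i)" for f
    proof -
      have "(\<Sum>i\<in>S'. (c(a := b)) i * M f i) = (\<Sum>i\<in>S'. c i * M f i)"
        by (rule sum.cong) (use S' in auto)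
      then show ?thesis using S' by simp
    qed
    have "(\<Sum>i\<in>S. (c(a := b)) i * M f i) = 0" if "f \<in> insert e E" for f
    proof (cases "f = e")
      case True
      have "(\<Sum>i\<in>S. (c(a := b)) i * M e i) = 0"
        unfolding sum_S using a by (simp add: b_def)
      with True show ?thesis by simp
    next
      case False
      then have "0 = (\<Sum>i\<in>S'. c i * (M f i - M f a * M e i / M e a))" using c that by auto
      also have "\<dots> = (\<Sum>i\<in>S'. c i * M f i) - M f a / M e a * (\<Sum>i\<in>S'. c i * M e i)"
        by (simp add: algebra_simps sum_subtractf sum_distrib_left)
      finally show ?thesis unfolding sum_S by (simp add: b_def)
    qed
    moreover have "\<exists>i\<in>S. (c(a := b)) i \<noteq> 0" using c(1) S' by auto
    ultimately show ?thesis by blast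
  qed
qed

text \<open>More than \<open>card J + 1\<close> points admit an affine dependence \<open>b\<close>.
  Subtracting multiples of \<open>b\<close> from the weights preserves the total weight and all
  moments, and the largest multiple that keeps the weights nonnegative makes one of them
  vanish.\<close>

lemma caratheodory_step:
  fixes V :: "'i \<Rightarrow> 'c \<Rightarrow> real" and u :: "'i \<Rightarrow> real"
  assumes "finite J" "finite S" "card J + 1 < card S" and u: "\<And>i. i \<in> S \<Longrightarrow> u i \<ge> 0"
  shows "\<exists>i0 u'. i0 \<in> S \<and> u' i0 = 0 \<and> (\<forall>i\<in>S. u' i \<ge> 0) \<and> (\<Sum>i\<in>S. u' i) = (\<Sum>i\<in>S. u i) \<and>
    (\<forall>c\<in>J. (\<Sum>i\<in>S. u' i * V i c) = (\<Sum>i\<in>S. u i * V i c))"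
proof -
  \<comment> \<open>The additional equation \<open>None\<close> demands that the coefficients sum to
    zero; it accounts for the \<open>+ 1\<close>.\<close>
  define M where "M e i = (case e of None \<Rightarrow> 1 | Some c \<Rightarrow> V i c)" for e i
  have "card (insert None (Some ` J)) < card S"
    using assms by (subst card_insert_disjoint) (auto simp: card_image)
  then obtain b where b: "\<exists>i\<in>S. b i \<noteq> 0"
    "\<And>e. e \<in> insert None (Some ` J) \<Longrightarrow> (\<Sum>i\<in>S. b i * M e i) = 0"
    using nontrivial_solution[of "insert None (Some ` J)" S M] assms by auto
  have b0: "(\<Sum>i\<in>S. b i) = 0" using b(2)[of None] by (simp add: M_def)
  have bV: "(\<Sum>i\<in>S. b i * V i c) = 0" if "c \<in> J" for c
    using b(2)[of "Some c"] that by (simp add: M_def)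
  define P where "P = {i\<in>S. b i > 0}"
  have "finite P" using assms by (simp add: P_def)
  have "P \<noteq> {}"
  proof
    assume "P = {}"
    then have "\<forall>i\<in>S. b i \<le> 0" by (force simp: P_def)
    then have "\<forall>i\<in>S. - b i = 0"
      using b0 assms by (subst sum_nonneg_eq_0_iff[symmetric]) (auto simp: sum_negf)
    with b(1) show False by auto
  qed
  then obtain i0 where i0: "i0 \<in> P" "\<And>i. i \<in> P \<Longrightarrow> u i0 / b i0 \<le> u i / b i"
    using ex_is_arg_min_if_finite[OF \<open>finite P\<close>, of "\<lambda>i. u i / b i"]
    by (auto simp: is_arg_min_linorder)
  \<comment> \<open>The smallest ratio over the positive entries of \<open>b\<close>: the first time
    at which a weight reaches zero.\<close>
  define t where "t = u i0 / b i0"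
  have t0: "t \<ge> 0" using i0 u by (auto simp: t_def P_def)
  show ?thesis
  proof (intro exI[of _ i0] exI[of _ "\<lambda>i. u i - t * b i"] conjI ballI)
    show "i0 \<in> S" "u i0 - t * b i0 = 0" using i0 by (auto simp: P_def t_def)
    fix i assume iS: "i \<in> S"
    show "u i - t * b i \<ge> 0"
    proof (cases "b i > 0")
      case True
      then have "t \<le> u i / b i" using i0 iS by (auto simp: P_def t_def)
      with True show ?thesis by (simp add: field_simps)
    next
      case False
      then have "t * b i \<le> 0" using t0 by (simp add: mult_nonneg_nonpos)
      with u[OF iS] show ?thesis by simp
    qed
  next
    show "(\<Sum>i\<in>S. u i - t * b i) = (\<Sum>i\<in>S. u i)"
      using b0 by (simp add: sum_subtractf flip: sum_distrib_left)
    fix c assume "c \<in> J"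
    have "(\<Sum>i\<in>S. (u i - t * b i) * V i c) = (\<Sum>i\<in>S. u i * V i c) - t * (\<Sum>i\<in>S. b i * V i c)"
      by (simp add: algebra_simps sum_subtractf sum_distrib_left)
    then show "(\<Sum>i\<in>S. (u i - t * b i) * V i c) = (\<Sum>i\<in>S. u i * V i c)"
      using bV[OF \<open>c \<in> J\<close>] by simp
  qed
qed

section \<open>Compactness arguments: attained minima, separation and coercivity\<close>

lemma compact_PiE_UNIV:
  fixes S :: "'i \<Rightarrow> 'b::topological_space set"
  assumes "\<And>i. compact (S i)"
  shows "compact (Pi\<^sub>E UNIV S)"
proof -
  have "compactin (product_topology (\<lambda>_. euclidean) UNIV) (Pi\<^sub>E UNIV S)"
    using assms by (subst compactin_PiE) auto
  then show ?thesis by (simp add: euclidean_product_topology)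
qed

lemma continuous_on_component:
  "continuous_on S (\<lambda>z::'i \<Rightarrow> 'b::topological_space. z i)"
  by (rule continuous_on_subset[OF continuous_on_product_coordinates]) simp

text \<open>The point \<open>t\<close> minimises the supremum over \<open>X\<close>, which is
  expressed by upper bounds because it may be infinite. Finitely many sublevel sets, taken at bounds
  that are attainable in \<open>K\<close>, share a point, namely a witness for the smallest of these
  bounds; compactness then gives a point common to all. Continuity in the parameter for each fixed
  \<open>x\<close> suffices for this.\<close>

lemma inf_sup_attained:
  fixes \<Psi> :: "'x \<Rightarrow> 't::topological_space \<Rightarrow> real"
  assumes "compact K" "K \<noteq> {}" and cont: "\<And>x. x \<in> X \<Longrightarrow> continuous_on UNIV (\<Psi> x)"
  obtains t where "t \<in> K"
    "\<And>s M x. s \<in> K \<Longrightarrow> \<forall>x\<in>X. \<Psi> x s \<le> M \<Longrightarrow> x \<in> X \<Longrightarrow> \<Psi> x t \<le> M"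
proof -
  define B where "B = {M. \<exists>s\<in>K. \<forall>x\<in>X. \<Psi> x s \<le> M}"
  have "K \<inter> (\<Inter>(x, M)\<in>X \<times> B. {s. \<Psi> x s \<le> M}) \<noteq> {}"
  proof (rule compact_imp_fip_image[OF \<open>compact K\<close>])
    fix i assume "i \<in> X \<times> B"
    then show "closed (case i of (x, M) \<Rightarrow> {s. \<Psi> x s \<le> M})"
      by (auto intro!: closed_Collect_le cont continuous_intros)
  next
    fix I' assume I': "finite I'" "I' \<subseteq> X \<times> B"
    show "K \<inter> (\<Inter>(x, M)\<in>I'. {s. \<Psi> x s \<le> M}) \<noteq> {}"
    proof (cases "I' = {}")
      case True
      then show ?thesis using assms by simp
    next
      case False
      define M0 where "M0 = Min (snd ` I')"
      have "M0 \<in> snd ` I'" using I' False unfolding M0_def by (intro Min_in) auto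
      then have "M0 \<in> B" using I' by auto
      then obtain s where s: "s \<in> K" "\<And>x. x \<in> X \<Longrightarrow> \<Psi> x s \<le> M0" by (auto simp: B_def)
      have "\<Psi> x s \<le> M" if "(x, M) \<in> I'" for x M
      proof -
        have "M \<in> snd ` I'" using that by force
        then have "M0 \<le> M" unfolding M0_def using I' by (intro Min_le) auto
        moreover have "\<Psi> x s \<le> M0" using s that I' by auto
        ultimately show ?thesis by simp
      qed
      with s show ?thesis by auto
    qed
  qed
  then obtain t where "t \<in> K" "\<And>x M. x \<in> X \<Longrightarrow> M \<in> B \<Longrightarrow> \<Psi> x t \<le> M" by auto
  then show thesis by (intro that[of t]) (auto simp: B_def)
qed

text \<open>Minimise the squared norm of the moment vector over all \<open>(card J + 1)\<close>-point weighted
  combinations. By Caratheodory the minimum does not decrease when one more point is mixed in, so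
  a nonzero minimiser is the normal of a separating hyperplane.\<close>

lemma balanced_or_separated:
  fixes V :: "'a::topological_space \<Rightarrow> 'c \<Rightarrow> real"
  assumes J: "finite J" and A: "compact A" "A \<noteq> {}"
    and V: "\<And>c. c \<in> J \<Longrightarrow> continuous_on A (\<lambda>x. V x c)"
  obtains (balanced) \<xi> :: "'a pmf" where "finite (set_pmf \<xi>)" "set_pmf \<xi> \<subseteq> A"
      "card (set_pmf \<xi>) \<le> card J + 1"
      "\<And>c. c \<in> J \<Longrightarrow> measure_pmf.expectation \<xi> (\<lambda>x. V x c) = 0"
  | (separated) d e where "e > 0" "\<And>x. x \<in> A \<Longrightarrow> (\<Sum>c\<in>J. d c * V x c) \<ge> e"
proof -
  define n where "n = card J"
  \<comment> \<open>An element lists weighted points, of which those with index at most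
    \<open>n\<close> form the convex combination. Every coordinate lies in the same compact factor,
    so the product over all indices is compact.\<close>
  define S :: "(nat \<Rightarrow> real \<times> 'a) set"
    where "S = Pi\<^sub>E UNIV (\<lambda>_. {0..1} \<times> A) \<inter> {z. (\<Sum>i\<le>n. fst (z i)) = 1}"
  define mom where "mom z c = (\<Sum>i\<le>n. fst (z i) * V (snd (z i)) c)" for z c
  define F where "F z = (\<Sum>c\<in>J. (mom z c)\<^sup>2)" for z
  have S_iff: "z \<in> S \<longleftrightarrow> (\<forall>i. 0 \<le> fst (z i) \<and> fst (z i) \<le> 1 \<and> snd (z i) \<in> A) \<and>
      (\<Sum>i\<le>n. fst (z i)) = 1" for z
    by (auto simp: S_def PiE_iff mem_Times_iff)
  have "compact S"
    unfolding S_def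
    by (intro compact_Int_closed compact_PiE_UNIV compact_Times A closed_Collect_eq
        continuous_intros continuous_on_component) auto
  obtain a where "a \<in> A" using A by auto
  have "(\<lambda>i. (of_bool (i = 0), a)) \<in> S"
    using \<open>a \<in> A\<close> by (simp add: S_iff of_bool_def)
  then have "S \<noteq> {}" by auto
  have contV: "continuous_on S (\<lambda>z. V (snd (z i)) c)" if "c \<in> J" for c i
    by (rule continuous_on_compose2[OF V[OF that]])
      (auto intro!: continuous_intros continuous_on_component simp: S_iff)
  have "continuous_on S F"
    unfolding F_def mom_def by (intro continuous_intros contV continuous_on_component)
  then obtain z where z: "z \<in> S" "\<And>y. y \<in> S \<Longrightarrow> F z \<le> F y"
    using continuous_attains_inf[OF \<open>compact S\<close> \<open>S \<noteq> {}\<close>] by blast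
  have mix: "F z \<le> (\<Sum>c\<in>J. ((1 - s) * mom z c + s * V x c)\<^sup>2)"
    if x: "x \<in> A" and s: "0 \<le> s" "s \<le> 1" for x s
  proof -
    \<comment> \<open>The mixture has \<open>n + 2\<close> points: the old ones with weights scaled
      by \<open>1 - s\<close>, and \<open>x\<close> at index \<open>Suc n\<close> with weight
      \<open>s\<close>. The Caratheodory step frees one index \<open>i0\<close>.\<close>
    define y where "y i = (if i \<le> n then snd (z i) else x)" for i
    define u where "u i = (if i \<le> n then (1 - s) * fst (z i) else s)" for i
    have card: "card J + 1 < card {..Suc n}" by (simp add: n_def)
    have u0: "u i \<ge> 0" for i using s z(1) by (auto simp: u_def S_iff)
    obtain i0 u' where "i0 \<in> {..Suc n} \<and> u' i0 = 0 \<and> (\<forall>i\<in>{..Suc n}. u' i \<ge> 0) \<and>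
      (\<Sum>i\<le>Suc n. u' i) = (\<Sum>i\<le>Suc n. u i) \<and>
      (\<forall>c\<in>J. (\<Sum>i\<le>Suc n. u' i * V (y i) c) = (\<Sum>i\<le>Suc n. u i * V (y i) c))"
      using caratheodory_step[OF J finite_atMost card, where u = u and V = "\<lambda>i. V (y i)"] u0 by blast
    then have u': "i0 \<le> Suc n" "u' i0 = 0" "\<And>i. i \<le> Suc n \<Longrightarrow> u' i \<ge> 0"
      "(\<Sum>i\<le>Suc n. u' i) = (\<Sum>i\<le>Suc n. u i)"
      "\<And>c. c \<in> J \<Longrightarrow> (\<Sum>i\<le>Suc n. u' i * V (y i) c) = (\<Sum>i\<le>Suc n. u i * V (y i) c)"
      by (simp_all del: sum.atMost_Suc)
    have su: "(\<Sum>i\<le>Suc n. u i) = 1"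
      using z(1) by (simp add: u_def S_iff flip: sum_distrib_left)
    have u'1: "u' i \<le> 1" if "i \<le> Suc n" for i
      using member_le_sum[of i "{..Suc n}" u'] u' su that by auto
    \<comment> \<open>The last index moves into the freed slot, so that the remaining points are
      numbered by \<open>{..n}\<close> again.\<close>
    define \<sigma> where "\<sigma> i = (if i = i0 then Suc n else i)" for i
    have \<sigma>: "bij_betw \<sigma> {..n} ({..Suc n} - {i0})"
      by (rule bij_betw_byWitness[where f' = "\<lambda>i. if i = Suc n then i0 else i"])
        (use u'(1) in \<open>auto simp: \<sigma>_def split: if_splits\<close>)
    have reindex: "(\<Sum>i\<le>n. u' (\<sigma> i) * h (\<sigma> i)) = (\<Sum>i\<le>Suc n. u' i * h i)" for h
    proof -
      have "(\<Sum>i\<le>n. u' (\<sigma> i) * h (\<sigma> i)) = (\<Sum>i\<in>{..Suc n} - {i0}. u' i * h i)"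
        by (rule sum.reindex_bij_betw[OF \<sigma>])
      also have "\<dots> = (\<Sum>i\<le>Suc n. u' i * h i)"
        by (rule sum.mono_neutral_left) (use u' in auto)
      finally show ?thesis .
    qed
    define z' where "z' i = (if i \<le> n then (u' (\<sigma> i), y (\<sigma> i)) else z i)" for i
    have \<sigma>_le: "\<sigma> i \<le> Suc n" if "i \<le> n" for i using that by (auto simp: \<sigma>_def)
    have "z' \<in> S"
      using z(1) x u'(3) u'1 \<sigma>_le reindex[of "\<lambda>_. 1"] u'(4) su
      by (auto simp: S_iff z'_def y_def)
    moreover have "mom z' c = (1 - s) * mom z c + s * V x c" if "c \<in> J" for c
    proof -
      have "mom z' c = (\<Sum>i\<le>n. u' (\<sigma> i) * V (y (\<sigma> i)) c)" by (simp add: mom_def z'_def)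
      also have "\<dots> = (\<Sum>i\<le>Suc n. u i * V (y i) c)" 
        using reindex[of "\<lambda>i. V (y i) c"] u'(5)[OF that] by simp
      also have "\<dots> = (1 - s) * mom z c + s * V x c"
        by (simp add: u_def y_def mom_def sum_distrib_left mult.assoc)
      finally show ?thesis .
    qed
    ultimately show ?thesis using z(2)[of z'] by (simp add: F_def)
  qed
  show thesis
  proof (cases "F z = 0")
    case False
    have "F z \<ge> 0" by (auto simp: F_def intro: sum_nonneg)
    with False have "F z > 0" by simp
    \<comment> \<open>This is the variational inequality for the point of a convex set nearest to
      the origin: moving from \<open>mom z\<close> towards \<open>V x\<close> cannot shorten the
      vector, so the one-sided derivative \<open>2 * P\<close> at \<open>s = 0\<close> is
      nonnegative. The normal is \<open>mom z\<close> and the gap is \<open>F z\<close>.\<close>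
    moreover have "(\<Sum>c\<in>J. mom z c * V x c) \<ge> F z" if "x \<in> A" for x
    proof -
      define P where "P = (\<Sum>c\<in>J. mom z c * (V x c - mom z c))"
      define Q where "Q = (\<Sum>c\<in>J. (V x c - mom z c)\<^sup>2)"
      have "0 \<le> 2 * P + s * Q" if s: "0 < s" "s \<le> 1" for s
      proof -
        have "F z \<le> (\<Sum>c\<in>J. ((1 - s) * mom z c + s * V x c)\<^sup>2)"
          using mix[OF \<open>x \<in> A\<close>] s by simp
        also have "\<dots> = F z + s * (2 * P + s * Q)"
          unfolding F_def P_def Q_def
          by (simp add: sum_distrib_left power2_eq_square algebra_simps flip: sum.distrib)
        finally show ?thesis using s by (simp add: zero_le_mult_iff)
      qed
      moreover have "Q \<ge> 0" by (auto simp: Q_def intro: sum_nonneg)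
      ultimately have P: "P \<ge> 0"
      proof -
        have "((\<lambda>s. 2 * P + s * Q) \<longlongrightarrow> 2 * P + 0 * Q) (at_right 0)"
          by (intro tendsto_intros)
        moreover have "\<forall>\<^sub>F s in at_right 0. 0 \<le> 2 * P + s * Q"
          using \<open>\<And>s. \<lbrakk>0 < s; s \<le> 1\<rbrakk> \<Longrightarrow> 0 \<le> 2 * P + s * Q\<close>
          by (intro eventually_at_rightI[of 0 1]) auto
        ultimately have "0 \<le> 2 * P + 0 * Q"
          by (intro tendsto_lowerbound) auto
        then show ?thesis by simp
      qed
      have "P = (\<Sum>c\<in>J. mom z c * V x c) - F z"
        by (simp add: P_def F_def algebra_simps power2_eq_square sum_subtractf)
      with P show ?thesis by simp
    qed
    ultimately show thesis by (rule separated)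
  next
    case True
    then have mom0: "mom z c = 0" if "c \<in> J" for c
      using J that by (simp add: F_def sum_nonneg_eq_0_iff)
    define w where "w i = (if i \<le> n then fst (z i) else 0)" for i
    have w0: "\<And>i. w i \<ge> 0" using z(1) by (auto simp: w_def S_iff)
    have "(\<integral>\<^sup>+i. ennreal (w i) \<partial>count_space UNIV) = (\<Sum>i\<le>n. ennreal (w i))"
      by (rule nn_integral_count_space'[of "{..n}"]) (auto simp: w_def)
    also have "\<dots> = ennreal (\<Sum>i\<le>n. w i)" using w0 by (simp add: sum_ennreal)
    also have "(\<Sum>i\<le>n. w i) = 1" using z(1) by (simp add: w_def S_iff)
    finally have w1: "(\<integral>\<^sup>+i. ennreal (w i) \<partial>count_space UNIV) = 1" by simp
    define N where "N = embed_pmf w"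
    have pmfN: "pmf N i = w i" for i unfolding N_def by (rule pmf_embed_pmf[OF w0 w1])
    have setN: "set_pmf N \<subseteq> {..n}" by (auto simp: set_pmf_eq pmfN w_def split: if_splits)
    \<comment> \<open>Pushing the weights forward from indices to points merges coinciding points,
      so the support has at most \<open>n + 1\<close> elements.\<close>
    define \<xi> where "\<xi> = map_pmf (\<lambda>i. snd (z i)) N"
    have set\<xi>: "set_pmf \<xi> \<subseteq> (\<lambda>i. snd (z i)) ` {..n}" using setN by (auto simp: \<xi>_def)
    show thesis
    proof (rule balanced[of \<xi>])
      show "finite (set_pmf \<xi>)" using set\<xi> by (rule finite_subset) simp
      show "set_pmf \<xi> \<subseteq> A" using set\<xi> z(1) by (auto simp: S_iff)
      have "card (set_pmf \<xi>) \<le> card {..n}" using set\<xi> by (rule surj_card_le[rotated]) simp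
      then show "card (set_pmf \<xi>) \<le> card J + 1" by (simp add: n_def)
      fix c assume "c \<in> J"
      have "measure_pmf.expectation \<xi> (\<lambda>x. V x c) = (\<Sum>i\<le>n. V (snd (z i)) c * pmf N i)"
        unfolding \<xi>_def integral_map_pmf
        by (rule integral_measure_pmf_real) (use setN in auto)
      also have "\<dots> = mom z c" by (simp add: mom_def pmfN w_def mult.commute)
      finally show "measure_pmf.expectation \<xi> (\<lambda>x. V x c) = 0" using mom0 \<open>c \<in> J\<close> by simp
    qed
  qed
qed

text \<open>On a finite-dimensional space the largest coefficient is controlled by the supremum norm
  of the function. Dividing by the entry of largest modulus reduces this to compact sets of
  normalised vectors, on which linear independence keeps the supremum away from zero.\<close>

lemma coefficient_bound:
  fixes g :: "'x \<Rightarrow> nat \<Rightarrow> real"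
  assumes indep: "\<And>c. (\<And>x. x \<in> X \<Longrightarrow> (\<Sum>l<d. c l * g x l) = 0) \<Longrightarrow> (\<And>l. l < d \<Longrightarrow> c l = 0)"
  shows "\<exists>K\<ge>0. \<forall>\<theta> C. (\<forall>x\<in>X. \<bar>\<Sum>l<d. \<theta> l * g x l\<bar> \<le> C) \<longrightarrow> C \<ge> 0 \<longrightarrow> (\<forall>l<d. \<bar>\<theta> l\<bar> \<le> K * C)"
proof -
  define \<phi> where "\<phi> x \<theta> = \<bar>\<Sum>l<d. \<theta> l * g x l\<bar>" for x and \<theta> :: "nat \<Rightarrow> real"
  \<comment> \<open>A face of the unit cube: entry \<open>l0\<close> equals 1, the others lie in
    \<open>{-1..1}\<close>, and entries from \<open>d\<close> on are pinned to 0 for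
    compactness.\<close>
  define S :: "nat \<Rightarrow> (nat \<Rightarrow> real) set"
    where "S l0 = Pi\<^sub>E UNIV (\<lambda>l. if l = l0 then {1} else if l < d then {-1..1} else {0})" for l0
  have "\<exists>e>0. \<forall>\<theta>\<in>S l0. \<exists>x\<in>X. \<phi> x \<theta> > e" if l0: "l0 < d" for l0
  proof -
    have cont: "continuous_on UNIV (\<phi> x)" for x
      unfolding \<phi>_def by (intro continuous_intros continuous_on_component)
    have "(\<lambda>l. if l = l0 then 1 else 0) \<in> S l0" by (auto simp: S_def PiE_iff)
    then have "compact (S l0)" "S l0 \<noteq> {}" by (auto simp: S_def intro!: compact_PiE_UNIV)
    then obtain t where t: "t \<in> S l0" and
      best: "\<And>s M x. s \<in> S l0 \<Longrightarrow> \<forall>x\<in>X. \<phi> x s \<le> M \<Longrightarrow> x \<in> X \<Longrightarrow> \<phi> x t \<le> M"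
      using inf_sup_attained[of "S l0" X \<phi>] cont by blast
    have "t l0 = 1" using t by (auto simp: S_def PiE_iff dest!: spec[of _ l0])
    then have "\<exists>x0\<in>X. (\<Sum>l<d. t l * g x0 l) \<noteq> 0" using indep[of t l0] l0 by auto
    then obtain x0 where x0: "x0 \<in> X" "\<phi> x0 t > 0" by (auto simp: \<phi>_def)
    \<comment> \<open>The supremum of \<open>\<phi>\<close> at \<open>s\<close> is at least
      \<open>\<phi> x0 t\<close> but need not be attained; half of this value is strictly exceeded
      at some point.\<close>
    have "\<exists>x\<in>X. \<phi> x s > \<phi> x0 t / 2" if "s \<in> S l0" for s
    proof (rule ccontr)
      assume "\<not> ?thesis"
      then have "\<forall>x\<in>X. \<phi> x s \<le> \<phi> x0 t / 2" by (simp add: not_less)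
      from best[OF that this x0(1)] have "\<phi> x0 t \<le> \<phi> x0 t / 2" .
      with x0 show False by simp
    qed
    then show ?thesis using x0 by (intro exI[of _ "\<phi> x0 t / 2"]) auto
  qed
  then obtain e where e: "\<And>l0. l0 < d \<Longrightarrow> e l0 > 0"
    "\<And>l0 \<theta>. l0 < d \<Longrightarrow> \<theta> \<in> S l0 \<Longrightarrow> \<exists>x\<in>X. \<phi> x \<theta> > e l0" by metis
  \<comment> \<open>The sum dominates every \<open>1 / e l\<close> and also makes sense for
    \<open>d = 0\<close>.\<close>
  define K where "K = (\<Sum>l<d. 1 / e l)"
  have "\<bar>\<theta> l\<bar> \<le> K * C"
    if bd: "\<forall>x\<in>X. \<bar>\<Sum>l<d. \<theta> l * g x l\<bar> \<le> C" and "C \<ge> 0" "l < d" for \<theta> C l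
  proof -
    obtain l0 where l0: "l0 < d" "\<And>i. i < d \<Longrightarrow> \<bar>\<theta> i\<bar> \<le> \<bar>\<theta> l0\<bar>"
    proof -
      have "Max ((\<lambda>l. \<bar>\<theta> l\<bar>) ` {..<d}) \<in> (\<lambda>l. \<bar>\<theta> l\<bar>) ` {..<d}"
        using \<open>l < d\<close> by (intro Max_in) auto
      then obtain l0 where "l0 < d" "Max ((\<lambda>l. \<bar>\<theta> l\<bar>) ` {..<d}) = \<bar>\<theta> l0\<bar>" by auto
      then show thesis using that[of l0] by (metis Max_ge finite_imageI finite_lessThan imageI lessThan_iff)
    qed
    have "\<bar>\<theta> l0\<bar> \<le> 1 / e l0 * C"
    proof (cases "\<theta> l0 = 0")
      case True
      then show ?thesis using e(1)[OF l0(1)] \<open>C \<ge> 0\<close> by simp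
    next
      case False
      define \<tau> where "\<tau> i = (if i < d then \<theta> i / \<theta> l0 else 0)" for i
      have "\<bar>\<theta> i / \<theta> l0\<bar> \<le> 1" if "i < d" for i using l0(2)[OF that] False by (simp add: abs_divide)
      then have "- 1 \<le> \<theta> i / \<theta> l0 \<and> \<theta> i / \<theta> l0 \<le> 1" if "i < d" for i
        using that by (metis abs_le_iff minus_le_iff)
      then have "\<tau> \<in> S l0" using False l0(1) by (simp add: S_def \<tau>_def PiE_iff)
      then obtain x where x: "x \<in> X" "\<phi> x \<tau> > e l0" using e(2) l0(1) by blast
      have "(\<Sum>l<d. \<tau> l * g x l) = (\<Sum>l<d. \<theta> l * g x l) / \<theta> l0"
        by (simp add: \<tau>_def sum_divide_distrib)
      then have "\<phi> x \<tau> \<le> C / \<bar>\<theta> l0\<bar>"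
        using bd x(1) by (simp add: \<phi>_def abs_divide divide_right_mono)
      with x(2) have "e l0 \<le> C / \<bar>\<theta> l0\<bar>" by simp
      then show ?thesis using False e(1)[OF l0(1)] by (simp add: field_simps)
    qed
    also have "\<dots> \<le> K * C"
      unfolding K_def using e(1) l0(1) \<open>C \<ge> 0\<close>
      by (intro mult_right_mono member_le_sum) (auto simp: less_imp_le)
    finally show ?thesis using l0(2)[OF \<open>l < d\<close>] by simp
  qed
  moreover have "K \<ge> 0" unfolding K_def using e(1) by (auto intro!: sum_nonneg simp: less_imp_le)
  ultimately show ?thesis by blast
qed

section \<open>The minimax regression problem and its saddle point\<close>

text \<open>An index \<open>q\<close> stands for an active pair (i, j), \<open>f q\<close> for the
  fixed function of model i at its given parameter, and \<open>g q\<close> for the regression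
  functions of model j. A model that is second in several pairs gets a separate parameter vector in
  each of them, which matches the way n counts dimensions.\<close>

locale linear_discrimination =
  fixes X :: "'a::topological_space set" and I :: "'q set" and w :: "'q \<Rightarrow> real"
    and f :: "'q \<Rightarrow> 'a \<Rightarrow> real" and g :: "'q \<Rightarrow> 'a \<Rightarrow> nat \<Rightarrow> real" and m :: "'q \<Rightarrow> nat"
  assumes X: "compact X" "X \<noteq> {}" and I: "finite I"
    and w: "\<And>q. q \<in> I \<Longrightarrow> w q > 0"
    and cont_f: "\<And>q. q \<in> I \<Longrightarrow> continuous_on X (f q)"
    and cont_g: "\<And>q l. q \<in> I \<Longrightarrow> l < m q \<Longrightarrow> continuous_on X (\<lambda>x. g q x l)"
    and indep: "\<And>q c l. q \<in> I \<Longrightarrow> (\<And>x. x \<in> X \<Longrightarrow> (\<Sum>l<m q. c l * g q x l) = 0) \<Longrightarrow> l < m q \<Longrightarrow> c l = 0"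
begin

definition J :: "('q \<times> nat) set"
  where "J = Sigma I (\<lambda>q. {..<m q})"

definition resid :: "('q \<times> nat \<Rightarrow> real) \<Rightarrow> 'q \<Rightarrow> 'a \<Rightarrow> real"
  where "resid \<theta> q x = f q x - (\<Sum>l<m q. \<theta> (q, l) * g q x l)"

definition \<Psi> :: "'a \<Rightarrow> ('q \<times> nat \<Rightarrow> real) \<Rightarrow> real"
  where "\<Psi> x \<theta> = (\<Sum>q\<in>I. w q * (resid \<theta> q x)\<^sup>2)"

lemma finite_J: "finite J"
  using I by (simp add: J_def)

lemma card_J: "card J = (\<Sum>q\<in>I. m q)"
  using I by (simp add: J_def)

lemma cont_resid: "q \<in> I \<Longrightarrow> continuous_on X (resid \<theta> q)"
  unfolding resid_def by (intro continuous_intros cont_f cont_g) auto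

lemma cont_\<Psi>: "continuous_on X (\<lambda>x. \<Psi> x \<theta>)"
  unfolding \<Psi>_def by (intro continuous_intros cont_resid)

text \<open>Coercivity reduces the problem to a compact box: if \<open>\<Psi>\<close> stays below
  its maximum \<open>M0\<close> at the zero parameter, then the residuals are bounded, hence so are
  the fitted functions, and by \<open>coefficient_bound\<close> so are the coefficients.\<close>

lemma minimax_parameter:
  obtains \<theta> M where "\<And>x. x \<in> X \<Longrightarrow> \<Psi> x \<theta> \<le> M" "\<exists>x\<in>X. \<Psi> x \<theta> = M"
    "\<And>\<theta>'. \<exists>x\<in>X. \<Psi> x \<theta>' \<ge> M"
proof -
  obtain x0 where x0: "x0 \<in> X" "\<And>x. x \<in> X \<Longrightarrow> \<Psi> x (\<lambda>_. 0) \<le> \<Psi> x0 (\<lambda>_. 0)"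
    using continuous_attains_sup[OF X cont_\<Psi>[of "\<lambda>_. 0"]] by blast
  define M0 where "M0 = \<Psi> x0 (\<lambda>_. 0)"
  have "M0 \<ge> 0" unfolding M0_def \<Psi>_def using w by (auto intro!: sum_nonneg simp: less_imp_le)
  have "\<exists>B. \<forall>x\<in>X. \<bar>f q x\<bar> \<le> B" if "q \<in> I" for q
  proof -
    have "continuous_on X (\<lambda>x. \<bar>f q x\<bar>)" using cont_f[OF that] by (intro continuous_intros)
    then show ?thesis using continuous_attains_sup[OF X] by blast
  qed
  then obtain B where B: "\<And>q x. q \<in> I \<Longrightarrow> x \<in> X \<Longrightarrow> \<bar>f q x\<bar> \<le> B q" by metis
  have "\<exists>K\<ge>0. \<forall>\<theta> C. (\<forall>x\<in>X. \<bar>\<Sum>l<m q. \<theta> l * g q x l\<bar> \<le> C) \<longrightarrow> C \<ge> 0 \<longrightarrow>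
      (\<forall>l<m q. \<bar>\<theta> l\<bar> \<le> K * C)" if "q \<in> I" for q
    by (rule coefficient_bound) (rule indep[OF that])
  then have "\<exists>K. \<forall>q\<in>I. K q \<ge> 0 \<and> (\<forall>\<theta> C. (\<forall>x\<in>X. \<bar>\<Sum>l<m q. \<theta> l * g q x l\<bar> \<le> C) \<longrightarrow> C \<ge> 0 \<longrightarrow>
      (\<forall>l<m q. \<bar>\<theta> l\<bar> \<le> K q * C))"
    by (intro bchoice ballI)
  then obtain K where K: "\<forall>q\<in>I. K q \<ge> 0 \<and> (\<forall>\<theta> C. (\<forall>x\<in>X. \<bar>\<Sum>l<m q. \<theta> l * g q x l\<bar> \<le> C) \<longrightarrow> C \<ge> 0 \<longrightarrow>
      (\<forall>l<m q. \<bar>\<theta> l\<bar> \<le> K q * C))" ..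
  \<comment> \<open>Bound for the fitted part: \<open>B q\<close> bounds \<open>f q\<close>, and the
    square root bounds the residual as long as \<open>\<Psi>\<close> is at most
    \<open>M0\<close>.\<close>
  define C where "C q = B q + sqrt (M0 / w q)" for q
  define R where "R = (\<Sum>q\<in>I. K q * C q)"
  have C0: "C q \<ge> 0" if "q \<in> I" for q
    using B[OF that x0(1)] w[OF that] \<open>M0 \<ge> 0\<close> by (auto simp: C_def intro!: add_nonneg_nonneg)
  have R0: "R \<ge> 0" unfolding R_def using K C0 by (auto intro!: sum_nonneg mult_nonneg_nonneg)
  have bounded: "\<bar>\<theta> (q, l)\<bar> \<le> R"
    if \<theta>: "\<And>x. x \<in> X \<Longrightarrow> \<Psi> x \<theta> \<le> M0" and q: "q \<in> I" and l: "l < m q" for \<theta> q l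
  proof -
    have "\<bar>\<Sum>l<m q. \<theta> (q, l) * g q x l\<bar> \<le> C q" if x: "x \<in> X" for x
    proof -
      have "w q * (resid \<theta> q x)\<^sup>2 \<le> \<Psi> x \<theta>"
        unfolding \<Psi>_def using w I q
        by (intro member_le_sum[of q I "\<lambda>q. w q * (resid \<theta> q x)\<^sup>2"]) (auto simp: less_imp_le)
      then have "w q * (resid \<theta> q x)\<^sup>2 \<le> M0" using \<theta>[OF x] by simp
      then have "(resid \<theta> q x)\<^sup>2 \<le> M0 / w q" using w[OF q] by (simp add: field_simps)
      then have "\<bar>resid \<theta> q x\<bar> \<le> sqrt (M0 / w q)" using real_le_rsqrt[of "\<bar>resid \<theta> q x\<bar>"] by simp
      then show ?thesis using B[OF q x] by (simp add: C_def resid_def)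
    qed
    then have "\<bar>\<theta> (q, l)\<bar> \<le> K q * C q" using conjunct2[OF bspec[OF K q], THEN spec, of "\<lambda>l. \<theta> (q, l)"] C0[OF q] l by simp
    also have "\<dots> \<le> R" unfolding R_def using I q K C0
      by (intro member_le_sum[of q I "\<lambda>q. K q * C q"]) auto
    finally show ?thesis .
  qed
  define box :: "('q \<times> nat \<Rightarrow> real) set"
    where "box = Pi\<^sub>E UNIV (\<lambda>c. if c \<in> J then {-R..R} else {0})"
  have "compact box" unfolding box_def by (intro compact_PiE_UNIV) auto
  have zero: "(\<lambda>_. 0) \<in> box" using R0 by (auto simp: box_def PiE_iff)
  have "continuous_on UNIV (\<Psi> x)" for x
    unfolding \<Psi>_def resid_def by (intro continuous_intros continuous_on_component)
  then obtain t where t: "t \<in> box"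
    and best: "\<And>s M x. s \<in> box \<Longrightarrow> \<forall>x\<in>X. \<Psi> x s \<le> M \<Longrightarrow> x \<in> X \<Longrightarrow> \<Psi> x t \<le> M"
    using inf_sup_attained[OF \<open>compact box\<close>, of X \<Psi>] zero by blast
  obtain x1 where x1: "x1 \<in> X" "\<And>x. x \<in> X \<Longrightarrow> \<Psi> x t \<le> \<Psi> x1 t"
    using continuous_attains_sup[OF X cont_\<Psi>[of t]] by blast
  show thesis
  proof (rule that[of t "\<Psi> x1 t"])
    show "\<Psi> x t \<le> \<Psi> x1 t" if "x \<in> X" for x using x1 that by simp
    show "\<exists>x\<in>X. \<Psi> x t = \<Psi> x1 t" using x1 by auto
    fix \<theta>' :: "'q \<times> nat \<Rightarrow> real"
    \<comment> \<open>Zeroing the coordinates outside \<open>J\<close> leaves \<open>\<Psi>\<close>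
      unchanged and is needed for membership in \<open>box\<close>.\<close>
    define \<theta> where "\<theta> c = (if c \<in> J then \<theta>' c else 0)" for c
    have "resid \<theta> q x = resid \<theta>' q x" if "q \<in> I" for q x
      using that by (simp add: resid_def \<theta>_def J_def)
    then have eq: "\<Psi> x \<theta> = \<Psi> x \<theta>'" for x by (simp add: \<Psi>_def)
    obtain x2 where x2: "x2 \<in> X" "\<And>x. x \<in> X \<Longrightarrow> \<Psi> x \<theta> \<le> \<Psi> x2 \<theta>"
      using continuous_attains_sup[OF X cont_\<Psi>[of \<theta>]] by blast
    have "\<Psi> x1 t \<le> \<Psi> x2 \<theta>"
    proof (cases "\<Psi> x2 \<theta> \<le> M0")
      case True
      then have "\<bar>\<theta> c\<bar> \<le> R" if "c \<in> J" for c
        using bounded[of \<theta> "fst c" "snd c"] x2(2) that by (force simp: J_def)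
      then have "\<theta> \<in> box" by (auto simp: box_def PiE_iff abs_le_iff \<theta>_def minus_le_iff)
      then show ?thesis using best x1(1) x2(2) by blast
    next
      \<comment> \<open>Here the maximum for \<open>\<theta>\<close> exceeds \<open>M0\<close>, the
        maximum at zero, and zero belongs to \<open>box\<close>.\<close>
      case False
      then show ?thesis using best[OF zero _ x1(1), of M0] x0(2) by (auto simp: M0_def)
    qed
    then show "\<exists>x\<in>X. \<Psi> x \<theta>' \<ge> \<Psi> x1 t" using x2(1) eq by auto
  qed
qed

text \<open>The score is \<open>-1/2\<close> times the gradient of \<open>\<Psi> x\<close> at \<open>\<theta>\<close>.\<close>

definition score :: "('q \<times> nat \<Rightarrow> real) \<Rightarrow> 'a \<Rightarrow> 'q \<times> nat \<Rightarrow> real"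
  where "score \<theta> x c = w (fst c) * (resid \<theta> (fst c) x * g (fst c) x (snd c))"

lemma sum_J: "(\<Sum>c\<in>J. h c) = (\<Sum>q\<in>I. \<Sum>l<m q. h (q, l))"
  unfolding J_def using I by (subst sum.Sigma) auto

text \<open>The expansion along \<open>d\<close> is exact, and its quadratic coefficient is free of
  \<open>\<theta>\<close>; this allows estimates that are uniform in \<open>x\<close>.\<close>

lemma \<Psi>_shift:
  "\<Psi> x (\<lambda>c. \<theta> c + s * d c) =
    \<Psi> x \<theta> - 2 * s * (\<Sum>c\<in>J. d c * score \<theta> x c) + s\<^sup>2 * (\<Sum>q\<in>I. w q * (\<Sum>l<m q. d (q, l) * g q x l)\<^sup>2)"
proof -
  have "resid (\<lambda>c. \<theta> c + s * d c) q x = resid \<theta> q x - s * (\<Sum>l<m q. d (q, l) * g q x l)" for q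
    by (simp add: resid_def algebra_simps sum.distrib sum_distrib_left)
  moreover have "(\<Sum>c\<in>J. d c * score \<theta> x c) =
      (\<Sum>q\<in>I. w q * resid \<theta> q x * (\<Sum>l<m q. d (q, l) * g q x l))"
    by (simp add: sum_J score_def sum_distrib_left mult_ac)
  moreover have "w q * (resid \<theta> q x - s * D)\<^sup>2 =
      w q * (resid \<theta> q x)\<^sup>2 - 2 * s * (w q * resid \<theta> q x * D) + s\<^sup>2 * (w q * D\<^sup>2)" for q D
    by (simp add: power2_diff power_mult_distrib algebra_simps)
  ultimately show ?thesis
    by (simp add: \<Psi>_def sum.distrib sum_subtractf flip: sum_distrib_left)
qed

text \<open>A small step along \<open>d\<close> would push \<open>\<Psi>\<close> below
  \<open>M\<close> on all of \<open>X\<close>: where the slope is large the linear term wins, and on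
  the compact remainder there is a positive gap to \<open>M\<close> which a small step cannot
  close.\<close>

lemma no_descent_at_minimax:
  assumes le: "\<And>x. x \<in> X \<Longrightarrow> \<Psi> x \<theta> \<le> M" and min: "\<And>\<theta>'. \<exists>x\<in>X. \<Psi> x \<theta>' \<ge> M"
    and "e > 0" and d: "\<And>x. x \<in> X \<Longrightarrow> \<Psi> x \<theta> = M \<Longrightarrow> (\<Sum>c\<in>J. d c * score \<theta> x c) \<ge> e"
  shows False
proof -
  define a where "a x = (\<Sum>c\<in>J. d c * score \<theta> x c)" for x
  define Q where "Q x = (\<Sum>q\<in>I. w q * (\<Sum>l<m q. d (q, l) * g q x l)\<^sup>2)" for x
  have conta: "continuous_on X a"
    unfolding a_def score_def
    by (intro continuous_intros cont_resid cont_g) (auto simp: J_def)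
  have contQ: "continuous_on X Q"
    unfolding Q_def by (intro continuous_intros cont_g) auto
  obtain B where B: "\<And>x. x \<in> X \<Longrightarrow> Q x \<le> B"
    using continuous_attains_sup[OF X contQ] by blast
  obtain A where A: "\<And>x. x \<in> X \<Longrightarrow> - 2 * a x \<le> A"
    using continuous_attains_sup[OF X continuous_on_mult_left[OF conta, of "-2"]] by blast
  \<comment> \<open>The slope \<open>a\<close> is at least \<open>e\<close> wherever
    \<open>\<Psi>\<close> equals \<open>M\<close>. With the threshold \<open>e / 2\<close>, the set
    \<open>K\<close> avoids these points, while off \<open>K\<close> the slope is still bounded away
    from zero.\<close>
  define K where "K = {x \<in> X. a x \<le> e / 2}"
  have "K = X \<inter> a -` {..e / 2}" by (auto simp: K_def)
  moreover have "closedin (top_of_set X) (X \<inter> a -` {..e / 2})"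
    by (rule continuous_closedin_preimage[OF conta]) simp
  ultimately have "compact K"
    using X(1) by (metis closedin_closed compact_Int_closed)
  have lt: "\<Psi> x \<theta> < M" if "x \<in> K" for x
    using that le[of x] d[of x] \<open>e > 0\<close> by (force simp: K_def a_def)
  obtain M' where M': "M' < M" "\<And>x. x \<in> K \<Longrightarrow> \<Psi> x \<theta> \<le> M'"
  proof (cases "K = {}")
    case True
    then show thesis using that[of "M - 1"] by simp
  next
    case False
    have "continuous_on K (\<lambda>x. \<Psi> x \<theta>)"
      by (rule continuous_on_subset[OF cont_\<Psi>]) (auto simp: K_def)
    then show thesis
      using continuous_attains_sup[OF \<open>compact K\<close> False] lt that by metis
  qed
  have small: "\<forall>\<^sub>F s in at_right 0. c + s * b < 0" if "c < 0" for b c :: real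
  proof -
    have "((\<lambda>s. c + s * b) \<longlongrightarrow> c + 0 * b) (at_right 0)" by (intro tendsto_intros)
    then show ?thesis using that by (auto dest: order_tendstoD(2)[where a = 0])
  qed
  have small2: "\<forall>\<^sub>F s in at_right 0. M' - M + s * (A + s * B) < 0"
  proof -
    have "((\<lambda>s. M' - M + s * (A + s * B)) \<longlongrightarrow> M' - M + 0 * (A + 0 * B)) (at_right 0)"
      by (intro tendsto_intros)
    then show ?thesis using M'(1) by (auto dest: order_tendstoD(2)[where a = 0])
  qed
  \<comment> \<open>One step size serves both regions: the first inequality is for points off
    \<open>K\<close>, the second for points of \<open>K\<close>.\<close>
  have "\<forall>\<^sub>F s in at_right 0. - e + s * B < 0 \<and> M' - M + s * (A + s * B) < 0 \<and> s > 0"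
    using small[of "-e" B] small2 \<open>e > 0\<close> by (intro eventually_conj eventually_at_right_less) auto
  then obtain s where s: "s > 0" "- e + s * B < 0" "M' - M + s * (A + s * B) < 0"
    by (auto dest: eventually_happens)
  obtain x where x: "x \<in> X" "M \<le> \<Psi> x (\<lambda>c. \<theta> c + s * d c)" using min by blast
  have shift: "\<Psi> x (\<lambda>c. \<theta> c + s * d c) = \<Psi> x \<theta> + s * (- 2 * a x + s * Q x)"
    unfolding \<Psi>_shift a_def Q_def by (simp add: power2_eq_square algebra_simps)
  have sQ: "s * Q x \<le> s * B" using B[OF x(1)] s by simp
  show False
  proof (cases "x \<in> K")
    case True
    have "s * (- 2 * a x + s * Q x) \<le> s * (A + s * B)"
      using add_mono[OF A[OF x(1)] sQ] s by (intro mult_left_mono) auto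
    with M'(2)[OF True] shift s x show False by simp
  next
    case False
    then have "e < 2 * a x" using x(1) by (simp add: K_def)
    then have "- 2 * a x + s * Q x < 0" using sQ s by linarith
    then have "s * (- 2 * a x + s * Q x) < 0" using s by (simp add: mult_pos_neg)
    with le[OF x(1)] shift x show False by simp
  qed
qed

text \<open>Each of \<open>\<xi>\<close> and \<open>\<theta>\<close> is a best response to the
  other: \<open>\<xi>\<close> sits on maximisers of \<open>\<Psi>\<close> at
  \<open>\<theta>\<close>, and the last conclusion states the normal equations, by which
  \<open>\<theta>\<close> is a least squares fit under \<open>\<xi>\<close>.\<close>

theorem saddle_point:
  obtains \<xi> \<theta> M where "finite (set_pmf \<xi>)" "set_pmf \<xi> \<subseteq> X" "card (set_pmf \<xi>) \<le> (\<Sum>q\<in>I. m q) + 1"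
    "\<And>x. x \<in> X \<Longrightarrow> \<Psi> x \<theta> \<le> M" "\<And>x. x \<in> set_pmf \<xi> \<Longrightarrow> \<Psi> x \<theta> = M"
    "\<And>q l. q \<in> I \<Longrightarrow> l < m q \<Longrightarrow> measure_pmf.expectation \<xi> (\<lambda>x. resid \<theta> q x * g q x l) = 0"
proof -
  obtain \<theta> M where \<theta>: "\<And>x. x \<in> X \<Longrightarrow> \<Psi> x \<theta> \<le> M" "\<exists>x\<in>X. \<Psi> x \<theta> = M"
    "\<And>\<theta>'. \<exists>x\<in>X. \<Psi> x \<theta>' \<ge> M"
    using minimax_parameter by blast
  define A where "A = {x \<in> X. \<Psi> x \<theta> = M}"
  have "A = X \<inter> (\<lambda>x. \<Psi> x \<theta>) -` {M}" by (auto simp: A_def)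
  moreover have "closedin (top_of_set X) (X \<inter> (\<lambda>x. \<Psi> x \<theta>) -` {M})"
    by (rule continuous_closedin_preimage[OF cont_\<Psi>]) simp
  ultimately have "compact A"
    using X(1) by (metis closedin_closed compact_Int_closed)
  have "A \<noteq> {}" using \<theta>(2) by (auto simp: A_def)
  have cont: "continuous_on A (\<lambda>x. score \<theta> x c)" if "c \<in> J" for c
  proof -
    have "continuous_on X (\<lambda>x. score \<theta> x c)"
      unfolding score_def using that
      by (intro continuous_intros cont_resid cont_g) (auto simp: J_def)
    then show ?thesis by (rule continuous_on_subset) (auto simp: A_def)
  qed
  show thesis
  proof (rule balanced_or_separated[OF finite_J \<open>compact A\<close> \<open>A \<noteq> {}\<close> cont])
    fix d e assume "e > 0" "\<And>x. x \<in> A \<Longrightarrow> (\<Sum>c\<in>J. d c * score \<theta> x c) \<ge> e"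
    then have False by (intro no_descent_at_minimax[OF \<theta>(1,3), of e d]) (auto simp: A_def)
    then show thesis ..
  next
    fix \<xi> assume balanced: "finite (set_pmf \<xi>)" "set_pmf \<xi> \<subseteq> A" "card (set_pmf \<xi>) \<le> card J + 1"
      "\<And>c. c \<in> J \<Longrightarrow> measure_pmf.expectation \<xi> (\<lambda>x. score \<theta> x c) = 0"
    show thesis
    proof (rule that[of \<xi> \<theta> M])
      fix q l assume "q \<in> I" "l < m q"
      then have "measure_pmf.expectation \<xi> (\<lambda>x. score \<theta> x (q, l)) = 0"
        by (intro balanced) (auto simp: J_def)
      then show "measure_pmf.expectation \<xi> (\<lambda>x. resid \<theta> q x * g q x l) = 0"
        using w[OF \<open>q \<in> I\<close>] by (simp add: score_def)
    qed (use balanced \<theta>(1) in \<open>auto simp: A_def card_J\<close>)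
  qed
qed

end

section \<open>From the saddle point back to the design criterion\<close>

theorem mainTheorem3:
  fixes X :: "'a :: topological_space set"
    and k :: nat
    and m :: "nat \<Rightarrow> nat"
    and g :: "nat \<Rightarrow> 'a \<Rightarrow> nat \<Rightarrow> real"
    and \<Theta> :: "nat \<Rightarrow> (nat \<Rightarrow> real) set"
    and \<eta> :: "nat \<Rightarrow> 'a \<Rightarrow> (nat \<Rightarrow> real) \<Rightarrow> real"
    and p :: "nat \<Rightarrow> nat \<Rightarrow> real"
    and \<rho> :: "nat \<Rightarrow> nat \<Rightarrow> real"
  assumes "compact X" and "X \<noteq> {}"
    and "\<And>j. j \<in> {1..k} \<Longrightarrow> \<Theta> j = Rn (m j)"
    and "\<And>j x. j \<in> {1..k} \<Longrightarrow> x \<in> X \<Longrightarrow> g j x \<in> Rn (m j)"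
    and "\<And>j. j \<in> {1..k} \<Longrightarrow> continuous_on X (g j)"
    and "\<And>j. j \<in> {1..k} \<Longrightarrow> lin_indep_components X (m j) (g j)"
    and "\<And>j x \<theta>. j \<in> {1..k} \<Longrightarrow> x \<in> X \<Longrightarrow> \<theta> \<in> \<Theta> j \<Longrightarrow> \<eta> j x \<theta> = inner_Rn (m j) \<theta> (g j x)"
    and "\<And>i j. (i, j) \<in> model_pairs k \<Longrightarrow> p i j \<ge> 0"
    and "(\<Sum>(i, j)\<in>model_pairs k. p i j) = 1"
    and "\<And>i j. (i, j) \<in> active_pairs k p \<Longrightarrow> \<rho> i \<in> \<Theta> i"
  shows "\<exists>\<xi>. Tp_optimal X k p \<Theta> \<eta> \<rho> \<xi> \<and>
    card (set_pmf \<xi>) \<le> (\<Sum>(i, j)\<in>active_pairs k p. m j) + 1"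
proof -
  define I where "I = active_pairs k p"
  have I_D: "fst q \<in> {1..k}" "snd q \<in> {1..k}" "p (fst q) (snd q) > 0" if "q \<in> I" for q
    using that by (auto simp: I_def active_pairs_def model_pairs_def)
  have "finite I"
    by (rule finite_subset[of _ "{1..k} \<times> {1..k}"])
      (auto simp: I_def active_pairs_def model_pairs_def)
  have cont_g: "continuous_on X (\<lambda>x. g j x l)" if "j \<in> {1..k}" for j l
    using assms(5)[OF that] by (rule continuous_on_product_then_coordinatewise)
  interpret linear_discrimination X I "\<lambda>q. p (fst q) (snd q)"
    "\<lambda>q x. inner_Rn (m (fst q)) (\<rho> (fst q)) (g (fst q) x)" "\<lambda>q. g (snd q)" "\<lambda>q. m (snd q)"
  proof
    show "compact X" "X \<noteq> {}" "finite I" by fact+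
    fix q assume q: "q \<in> I"
    show "p (fst q) (snd q) > 0" using I_D q by simp
    show "continuous_on X (\<lambda>x. inner_Rn (m (fst q)) (\<rho> (fst q)) (g (fst q) x))"
      unfolding inner_Rn_def by (intro continuous_intros cont_g I_D q)
    show "continuous_on X (\<lambda>x. g (snd q) x l)" for l
      by (intro cont_g I_D q)
    fix c l assume c: "\<And>x. x \<in> X \<Longrightarrow> (\<Sum>l<m (snd q). c l * g (snd q) x l) = 0"
      and l: "l < m (snd q)"
    \<comment> \<open>Independence is assumed for extensional vectors, so \<open>c\<close> is first
      cut down to its relevant entries.\<close>
    have "restrict c {..<m (snd q)} \<in> Rn (m (snd q))" by (simp add: Rn_def)
    with assms(6)[OF I_D(2)[OF q]] c l show "c l = 0"
      unfolding lin_indep_components_def by fastforce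
  qed
  obtain \<xi> \<theta> M where \<xi>: "finite (set_pmf \<xi>)" "set_pmf \<xi> \<subseteq> X"
      "card (set_pmf \<xi>) \<le> (\<Sum>q\<in>I. m (snd q)) + 1"
    and M: "\<And>x. x \<in> X \<Longrightarrow> \<Psi> x \<theta> \<le> M" "\<And>x. x \<in> set_pmf \<xi> \<Longrightarrow> \<Psi> x \<theta> = M"
    and normal: "\<And>q l. q \<in> I \<Longrightarrow> l < m (snd q) \<Longrightarrow>
      measure_pmf.expectation \<xi> (\<lambda>x. resid \<theta> q x * g (snd q) x l) = 0"
    using saddle_point by blast
  define T where "T = T_crit k p \<Theta> \<eta> \<rho>"
  have T_eq: "T \<zeta> = (\<Sum>q\<in>I. p (fst q) (snd q) * (INF \<tau>\<in>\<Theta> (snd q).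
      measure_pmf.expectation \<zeta> (\<lambda>x. (\<eta> (fst q) x (\<rho> (fst q)) - \<eta> (snd q) x \<tau>)\<^sup>2)))" for \<zeta>
    by (simp add: T_def T_crit_def I_def case_prod_beta)
  \<comment> \<open>The block of \<open>\<theta>\<close> that belongs to pair \<open>q\<close>, made
    extensional so that it is an admissible parameter.\<close>
  define par where "par q = restrict (\<lambda>l. \<theta> (q, l)) {..<m (snd q)}" for q
  have par: "par q \<in> \<Theta> (snd q)" if "q \<in> I" for q
    using assms(3)[OF I_D(2)[OF that]] by (simp add: par_def Rn_def)
  have \<rho>: "\<rho> (fst q) \<in> \<Theta> (fst q)" if "q \<in> I" for q
    using assms(10)[of "fst q" "snd q"] that by (simp add: I_def)
  have diff: "\<eta> (fst q) x (\<rho> (fst q)) - \<eta> (snd q) x \<tau> =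
      resid \<theta> q x - (\<Sum>l<m (snd q). (\<tau> l - \<theta> (q, l)) * g (snd q) x l)"
    if "q \<in> I" "x \<in> X" "\<tau> \<in> \<Theta> (snd q)" for q x \<tau>
    using assms(7)[OF I_D(1)[OF that(1)] that(2) \<rho>[OF that(1)]]
      assms(7)[OF I_D(2)[OF that(1)] that(2,3)]
    unfolding resid_def by (simp add: inner_Rn_def left_diff_distrib sum_subtractf)
  have diff_par: "\<eta> (fst q) x (\<rho> (fst q)) - \<eta> (snd q) x (par q) = resid \<theta> q x"
    if "q \<in> I" "x \<in> X" for q x
    using diff[OF that par[OF that(1)]] by (simp add: par_def)
  have integrable: "integrable (measure_pmf \<zeta>) h" if "is_design X \<zeta>" for \<zeta> and h :: "'a \<Rightarrow> real"
    using that by (intro integrable_measure_pmf_finite) (simp add: is_design_def)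
  \<comment> \<open>Weak duality: inserting \<open>par q\<close> into the infima bounds the
    criterion by the mean of \<open>\<Psi>\<close> at \<open>\<theta>\<close>, hence by its
    maximum.\<close>
  have upper: "T \<zeta> \<le> M" if \<zeta>: "is_design X \<zeta>" for \<zeta>
  proof -
    have "T \<zeta> \<le> (\<Sum>q\<in>I. p (fst q) (snd q) * measure_pmf.expectation \<zeta> (\<lambda>x. (resid \<theta> q x)\<^sup>2))"
      unfolding T_eq
    proof (intro sum_mono mult_left_mono)
      fix q assume q: "q \<in> I"
      show "0 \<le> p (fst q) (snd q)" using I_D(3)[OF q] by simp
      have "(INF \<tau>\<in>\<Theta> (snd q). measure_pmf.expectation \<zeta> (\<lambda>x. (\<eta> (fst q) x (\<rho> (fst q)) - \<eta> (snd q) x \<tau>)\<^sup>2))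
          \<le> measure_pmf.expectation \<zeta> (\<lambda>x. (\<eta> (fst q) x (\<rho> (fst q)) - \<eta> (snd q) x (par q))\<^sup>2)"
        by (rule cINF_lower[OF bdd_belowI[of _ 0] par[OF q]]) auto
      also have "\<dots> = measure_pmf.expectation \<zeta> (\<lambda>x. (resid \<theta> q x)\<^sup>2)"
        using \<zeta> diff_par[OF q]
        by (intro integral_cong_AE) (auto simp: AE_measure_pmf_iff is_design_def)
      finally show "(INF \<tau>\<in>\<Theta> (snd q). measure_pmf.expectation \<zeta> (\<lambda>x. (\<eta> (fst q) x (\<rho> (fst q)) - \<eta> (snd q) x \<tau>)\<^sup>2))
          \<le> measure_pmf.expectation \<zeta> (\<lambda>x. (resid \<theta> q x)\<^sup>2)" .
    qed
    also have "\<dots> = measure_pmf.expectation \<zeta> (\<lambda>x. \<Psi> x \<theta>)"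
      unfolding \<Psi>_def by (subst Bochner_Integration.integral_sum) (auto intro: integrable \<zeta>)
    also have "\<dots> \<le> measure_pmf.expectation \<zeta> (\<lambda>_. M)"
      using \<zeta> M(1) by (intro integral_mono_AE integrable)
        (auto simp: AE_measure_pmf_iff is_design_def)
    finally show ?thesis by simp
  qed
  have design: "is_design X \<xi>" using \<xi> by (simp add: is_design_def)
  \<comment> \<open>Under \<open>\<xi>\<close> the mean of \<open>\<Psi>\<close> at
    \<open>\<theta>\<close> is exactly \<open>M\<close>, and the normal equations show that no other
    parameter makes a squared residual integral smaller.\<close>
  have lower: "M \<le> T \<xi>"
  proof -
    have "M = measure_pmf.expectation \<xi> (\<lambda>_. M)" by simp
    also have "\<dots> = measure_pmf.expectation \<xi> (\<lambda>x. \<Psi> x \<theta>)"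
      using M(2) by (intro integral_cong_AE) (auto simp: AE_measure_pmf_iff)
    also have "\<dots> = (\<Sum>q\<in>I. p (fst q) (snd q) * measure_pmf.expectation \<xi> (\<lambda>x. (resid \<theta> q x)\<^sup>2))"
      unfolding \<Psi>_def by (subst Bochner_Integration.integral_sum) (auto intro: integrable design)
    also have "\<dots> \<le> T \<xi>"
      unfolding T_eq
    proof (intro sum_mono mult_left_mono cINF_greatest)
      fix q assume q: "q \<in> I"
      show "0 \<le> p (fst q) (snd q)" using I_D(3)[OF q] by simp
      show "\<Theta> (snd q) \<noteq> {}" using par[OF q] by auto
      fix \<tau> assume \<tau>: "\<tau> \<in> \<Theta> (snd q)"
      define h where "h x = (\<Sum>l<m (snd q). (\<tau> l - \<theta> (q, l)) * g (snd q) x l)" for x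
      have "measure_pmf.expectation \<xi> (\<lambda>x. resid \<theta> q x * h x) =
          (\<Sum>l<m (snd q). (\<tau> l - \<theta> (q, l)) * measure_pmf.expectation \<xi> (\<lambda>x. resid \<theta> q x * g (snd q) x l))"
        unfolding h_def sum_distrib_left
        by (subst Bochner_Integration.integral_sum)
          (auto intro: integrable design simp: mult.left_commute)
      then have orth: "measure_pmf.expectation \<xi> (\<lambda>x. resid \<theta> q x * h x) = 0"
        using normal[OF q] by simp
      \<comment> \<open>The cross term integrates to zero by orthogonality; the comparison after
        that omits the nonnegative square of \<open>h\<close>.\<close>
      have "measure_pmf.expectation \<xi> (\<lambda>x. (resid \<theta> q x)\<^sup>2) =
          measure_pmf.expectation \<xi> (\<lambda>x. (resid \<theta> q x)\<^sup>2 - 2 * (resid \<theta> q x * h x))"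
        by (subst Bochner_Integration.integral_diff) (auto intro: integrable design simp: orth)
      also have "\<dots> \<le> measure_pmf.expectation \<xi> (\<lambda>x. (resid \<theta> q x - h x)\<^sup>2)"
        by (intro integral_mono integrable design) (simp add: power2_diff)
      also have "\<dots> = measure_pmf.expectation \<xi> (\<lambda>x. (\<eta> (fst q) x (\<rho> (fst q)) - \<eta> (snd q) x \<tau>)\<^sup>2)"
        using \<xi>(2) diff[OF q _ \<tau>]
        by (intro integral_cong_AE) (auto simp: AE_measure_pmf_iff h_def)
      finally show "measure_pmf.expectation \<xi> (\<lambda>x. (resid \<theta> q x)\<^sup>2) \<le>
          measure_pmf.expectation \<xi> (\<lambda>x. (\<eta> (fst q) x (\<rho> (fst q)) - \<eta> (snd q) x \<tau>)\<^sup>2)" .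
    qed
    finally show ?thesis .
  qed
  have "Tp_optimal X k p \<Theta> \<eta> \<rho> \<xi>"
    using design upper lower by (force simp: Tp_optimal_def T_def)
  with \<xi>(3) show ?thesis by (auto simp: I_def case_prod_beta)
qed

end
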